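(* Every binary convolutional code that can be constructed with the generalized building-up construction can be constructed with the generalized Harada-Munemasa construction, but not vice versa: there exists a binary self-dual convolutional code that can be constructed with the generalized Harada-Munemasa construction but cannot be constructed with the generalized building-up construction.
   Context: A binary $(n,k)$ convolutional code is an $\mathbb{F}_2[z]$-submodule $\mathcal{C}\subset\mathbb{F}_2[z]^n$ of rank $k$. A generator matrix of $\mathcal{C}$ is a matrix in $\mathbb{F}_2[z]^{k\times n}$ whose rows form a basis of $\mathcal{C}$. The dual is $\mathcal{C}^\perp=\{f(z)\in\mathbb{F}_2[z]^n : f(z)c(z)^\top=0\ \forall c(z)\in\mathcal{C}\}$, and $\mathcal{C}$ is self-dual if $\mathcal{C}=\mathcal{C}^\perp$. A code can be constructed with one of the following constructions if it has a generator matrix produced by it. In both, $G(z)\in\mathbb{F}_2[z]^{k\times 2k}$ is a generator matrix, with rows $g_1(z),\dots,g_k(z)$, of a binary self-dual $(2k,k)$ convolutional code. Generalized building-up construction (binary case): choose $f(z)\in\mathbb{F}_2[z]^{2k}$ with $f(z)f(z)^\top=1$, put $y_i(z)=f(z)g_i(z)^\top$, and form the $(k+1)\times(2k+2)$ matrix with first row $(1,0,f(z))$ and further rows $(y_i(z),y_i(z),g_i(z))$, $1\le i\le k$ (this generates a self-dual code). Generalized Harada-Munemasa construction: choose $a_1(z),\dots,a_k(z)\in\mathbb{F}_2[z]$ and $f(z)\in\mathbb{F}_2[z]^{2k+2}$ such that the $(k+1)\times(2k+2)$ matrix with first row $f(z)$ and further rows $(a_i(z),a_i(z),g_i(z))$,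 $1\le i\le k$, generates a self-dual convolutional code. *)

theory Defs
  imports "Jordan_Normal_Form.VS_Connect" "HOL-Library.Z2"
begin

abbreviation poly_module :: "nat \<Rightarrow> (bit poly, bit poly vec) module"
  where "poly_module n \<equiv> module_vec TYPE(bit poly) n"

text \<open>
  The rows are a basis as an indexed family; since linear independence is only available
  for sets of vectors, repeated rows have to be excluded separately.
\<close>

definition generator_matrix :: "nat \<Rightarrow> nat \<Rightarrow> bit poly vec set \<Rightarrow> bit poly mat \<Rightarrow> bool"
  where "generator_matrix n k C G \<longleftrightarrow>
    G \<in> carrier_mat k n \<and>
    distinct (rows G) \<and>
    \<not> LinearCombinations.module.lin_dep class_ring (poly_module n) (set (rows G)) \<and>
    LinearCombinations.module.span class_ring (poly_module n) (set (rows G)) = C"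

text \<open>
  The polynomials over the two-element field form a principal ideal domain, so every submodule
  of a finitely generated free module is free, and its rank is the size of a basis.
\<close>

definition convolutional_code :: "nat \<Rightarrow> nat \<Rightarrow> bit poly vec set \<Rightarrow> bool"
  where "convolutional_code n k C \<longleftrightarrow>
    LinearCombinations.submodule class_ring C (poly_module n) \<and>
    (\<exists>G. generator_matrix n k C G)"

definition dual_code :: "nat \<Rightarrow> bit poly vec set \<Rightarrow> bit poly vec set"
  where "dual_code n C = {f \<in> carrier_vec n. \<forall>c\<in>C. f \<bullet> c = 0}"

definition self_dual_code :: "nat \<Rightarrow> nat \<Rightarrow> bit poly vec set \<Rightarrow> bool"
  where "self_dual_code n k C \<longleftrightarrow> convolutional_code n k C \<and> C = dual_code n C"

definition generates_self_dual :: "nat \<Rightarrow> nat \<Rightarrow> bit poly mat \<Rightarrow> bool"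
  where "generates_self_dual n k G \<longleftrightarrow>
    (\<exists>C. self_dual_code n k C \<and> generator_matrix n k C G)"

definition building_up_matrix :: "nat \<Rightarrow> bit poly mat \<Rightarrow> bit poly vec \<Rightarrow> bit poly mat"
  where "building_up_matrix k G f =
    mat_of_rows (2 * k + 2)
      (vCons 1 (vCons 0 f) #
       map (\<lambda>i. vCons (f \<bullet> row G i) (vCons (f \<bullet> row G i) (row G i))) [0..<k])"

definition harada_munemasa_matrix ::
    "nat \<Rightarrow> bit poly mat \<Rightarrow> bit poly vec \<Rightarrow> bit poly vec \<Rightarrow> bit poly mat"
  where "harada_munemasa_matrix k G a f =
    mat_of_rows (2 * k + 2)
      (f # map (\<lambda>i. vCons (a $ i) (vCons (a $ i) (row G i))) [0..<k])"

text \<open>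
  Both constructions start from a nonempty matrix, that is, \<open>k \<ge> 1\<close>. For building-up this is
  implied by \<open>f \<bullet> f = 1\<close>; for the other construction it excludes the degenerate case where the
  matrix consists of the single row \<open>f\<close> of length 2.
\<close>

definition building_up_matrices :: "bit poly mat set"
  where "building_up_matrices =
    {building_up_matrix k G f | k G f.
      1 \<le> k \<and> generates_self_dual (2 * k) k G \<and>
      f \<in> carrier_vec (2 * k) \<and> f \<bullet> f = 1}"

definition harada_munemasa_matrices :: "bit poly mat set"
  where "harada_munemasa_matrices =
    {harada_munemasa_matrix k G a f | k G a f.
      1 \<le> k \<and> generates_self_dual (2 * k) k G \<and>
      a \<in> carrier_vec k \<and> f \<in> carrier_vec (2 * k + 2) \<and>
      generates_self_dual (2 * k + 2) (k + 1) (harada_munemasa_matrix k G a f)}"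

definition constructible :: "bit poly mat set \<Rightarrow> nat \<Rightarrow> nat \<Rightarrow> bit poly vec set \<Rightarrow> bool"
  where "constructible Ms n k C \<longleftrightarrow> (\<exists>M\<in>Ms. generator_matrix n k C M)"

end

theory Submission
  imports Defs
begin

text \<open>
  A building-up matrix is a Harada-Munemasa matrix with \<open>a\<^sub>i = y\<^sub>i\<close> and first row
  \<open>(1, 0, f)\<close>, so the inclusion amounts to self-duality of the code it generates. Every
  building-up code contains a vector of the form \<open>(1, 0, f)\<close>. The code of all
  \<open>(a, a, b, b)\<close> does not, although it arises from the repetition code \<open>(b, b)\<close>
  by the Harada-Munemasa construction with first row \<open>(1, 1, 0, 0)\<close>.
\<close>

section \<open>Spans and linear independence of coordinate vectors\<close>

context vec_module
begin

lemma scalar_mult_in_span: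
  assumes "W \<subseteq> carrier_vec n" "x \<in> span W"
  shows "c \<cdot>\<^sub>v x \<in> span W"
proof -
  interpret W: submodule class_ring "span W" V
    using span_is_submodule assms(1) by simp
  show ?thesis
    using W.smult_closed assms(2) by (simp add: module_vec_simps)
qed

lemma add_in_span:
  assumes "W \<subseteq> carrier_vec n" "x \<in> span W" "y \<in> span W"
  shows "x + y \<in> span W"
proof -
  interpret W: submodule class_ring "span W" V
    using span_is_submodule assms(1) by simp
  show ?thesis
    using W.m_closed assms(2,3) by (simp add: module_vec_simps)
qed

lemma zero_in_span:
  assumes "W \<subseteq> carrier_vec n"
  shows "0\<^sub>v n \<in> span W"
proof -
  interpret W: submodule class_ring "span W" V
    using span_is_submodule assms(1) by simp
  show ?thesis
    using W.zero_closed by (simp add: module_vec_simps)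
qed

text \<open>Serves as induction over a span: \<open>N\<close> is the set of vectors with the desired
  property, checked on the generators and under the vector operations.\<close>

lemma span_subset_closed:
  assumes "W \<subseteq> N" "N \<subseteq> carrier_vec n" "0\<^sub>v n \<in> N"
    "\<And>x y. x \<in> N \<Longrightarrow> y \<in> N \<Longrightarrow> x + y \<in> N"
    "\<And>c x. x \<in> N \<Longrightarrow> c \<cdot>\<^sub>v x \<in> N"
  shows "span W \<subseteq> N"
proof (rule span_is_subset)
  show "submodule class_ring N V"
    using assms(2-5) module_axioms
    by unfold_locales (auto simp: module_vec_simps)
qed (fact assms(1))

text \<open>Read at the pivot coordinate of \<open>v\<close>, a vanishing combination retains only
  the coefficient of \<open>v\<close>. Nothing is divided, so polynomial entries are
  allowed.\<close>

lemma lin_indpt_pivots: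
  assumes "finite A" "A \<subseteq> carrier_vec n"
    and piv: "\<And>v. v \<in> A \<Longrightarrow> \<exists>i<n. v $ i = 1 \<and> (\<forall>w\<in>A - {v}. w $ i = 0)"
  shows "lin_indpt A"
proof (rule finite_lin_indpt2)
  fix a
  assume lc: "lincomb a A = 0\<^sub>v n"
  show "\<forall>v\<in>A. a v = 0"
  proof
    fix v assume v: "v \<in> A"
    obtain i where i: "i < n" "v $ i = 1" "\<forall>w\<in>A - {v}. w $ i = 0"
      using piv[OF v] by blast
    have "0 = lincomb a A $ i"
      using lc i(1) by simp
    also have "\<dots> = (\<Sum>w\<in>A. (a w \<cdot>\<^sub>v w) $ i)"
      unfolding lincomb_def using assms(2) i(1) by (intro finsum_index) auto
    also have "\<dots> = (\<Sum>w\<in>A. a w * w $ i)"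
      using assms(2) i(1) by (intro sum.cong) auto
    also have "\<dots> = a v"
      using i v assms(1) by (simp add: sum.remove)
    finally show "a v = 0" by simp
  qed
qed (use assms in auto)

end

section \<open>Duals of spans and a criterion for self-duality\<close>

text \<open>The vectors orthogonal to a fixed \<open>x\<close> form a submodule, so orthogonality
  passes from generators to their span.\<close>

lemma dual_code_span:
  assumes S: "S \<subseteq> carrier_vec n"
  shows "dual_code n (LinearCombinations.module.span class_ring (poly_module n) S) = dual_code n S"
proof -
  interpret vec_module "TYPE(bit poly)" n .
  have "x \<bullet> y = 0" if x: "x \<in> carrier_vec n" "\<forall>s\<in>S. x \<bullet> s = 0" and y: "y \<in> span S" for x y
  proof -
    have "span S \<subseteq> {y \<in> carrier_vec n. x \<bullet> y = 0}"
      using S x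
      by (intro span_subset_closed) (auto simp: scalar_prod_add_distrib[of _ n])
    then show ?thesis using y by blast
  qed
  moreover have "S \<subseteq> span S"
    using S in_own_span by simp
  ultimately show ?thesis
    by (auto simp: dual_code_def)
qed

lemma generator_matrixD:
  assumes "generator_matrix n k C G"
  shows "G \<in> carrier_mat k n" "set (rows G) \<subseteq> carrier_vec n" "set (rows G) \<subseteq> C"
    "C \<subseteq> carrier_vec n" "submodule class_ring C (poly_module n)"
proof -
  interpret vec_module "TYPE(bit poly)" n .
  show G: "G \<in> carrier_mat k n"
    using assms by (simp add: generator_matrix_def)
  then show R: "set (rows G) \<subseteq> carrier_vec n"
    using rows_carrier[of G] by simp
  have C: "C = span (set (rows G))"
    using assms by (simp add: generator_matrix_def)
  show "set (rows G) \<subseteq> C" "C \<subseteq> carrier_vec n" "submodule class_ring C (poly_module n)"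
    unfolding C using R in_own_span span_is_subset2 span_is_submodule by auto
qed

text \<open>Reduces self-duality to conditions on the rows of one generator matrix, since the dual
  of the code is already the dual of the rows.\<close>

lemma self_dual_codeI:
  assumes gm: "generator_matrix n k C G"
    and ort: "\<And>u v. u \<in> set (rows G) \<Longrightarrow> v \<in> set (rows G) \<Longrightarrow> u \<bullet> v = 0"
    and dual: "dual_code n (set (rows G)) \<subseteq> C"
  shows "self_dual_code n k C"
proof -
  interpret vec_module "TYPE(bit poly)" n .
  note G = generator_matrixD[OF gm]
  have C: "C = span (set (rows G))"
    using gm by (simp add: generator_matrix_def)
  have "set (rows G) \<subseteq> dual_code n (set (rows G))"
    using G(2) ort by (auto simp: dual_code_def)
  then have "set (rows G) \<subseteq> dual_code n C"
    unfolding C dual_code_span[OF G(2)] .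
  then have "u \<bullet> c = 0" if "u \<in> set (rows G)" "c \<in> C" for u c
    using that by (auto simp: dual_code_def)
  \<comment> \<open>By symmetry the codeword moves to the left, so orthogonality, so far extended to
    the span in the right argument only, extends in both.\<close>
  then have "c \<bullet> u = 0" if "u \<in> set (rows G)" "c \<in> C" for u c
    using that G(2,4) comm_scalar_prod[of c n u] by auto
  then have "C \<subseteq> dual_code n (set (rows G))"
    using G(4) by (auto simp: dual_code_def)
  then have "C = dual_code n C"
    using dual unfolding C dual_code_span[OF G(2)] by blast
  then show ?thesis
    using gm G(5) by (auto simp: self_dual_code_def convolutional_code_def)
qed

section \<open>Splitting off coordinates, and characteristic two\<close>

lemma vCons_add [simp]: "vCons a v + vCons b w = vCons (a + b) (v + w)"
  by (rule eq_vecI) (auto simp: less_Suc_eq_0_disj)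

lemma smult_vCons [simp]: "c \<cdot>\<^sub>v vCons a v = vCons (c * a) (c \<cdot>\<^sub>v v)"
  by (rule eq_vecI) (auto simp: less_Suc_eq_0_disj)

lemma carrier_vec_Suc_iff: "v \<in> carrier_vec (Suc n) \<longleftrightarrow> (\<exists>a w. v = vCons a w \<and> w \<in> carrier_vec n)"
  by (cases v) (auto dest: arg_cong[of _ _ dim_vec])

lemma carrier_vec_0_iff: "v \<in> carrier_vec 0 \<longleftrightarrow> v = vNil"
  by (cases v) (auto dest: carrier_vecD)

lemma bit_poly_2 [simp]: "2 = (0 :: bit poly)"
  by (rule poly_eqI) (simp add: numeral_poly)

lemma bit_poly_uminus [simp]: "- p = (p :: bit poly)"
  by (rule poly_eqI) simp

lemma bit_poly_add_eq_0_iff: "p + q = 0 \<longleftrightarrow> p = (q :: bit poly)"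
  by (metis add_eq_0_iff bit_poly_uminus)

section \<open>Self-duality of building-up codes\<close>

text \<open>
  Subtracting \<open>(u + v)(1, 0, f)\<close> from a dual vector \<open>(u, v, w)\<close> leaves a vector whose last
  part \<open>x = w + (u + v) f\<close> is orthogonal to the rows of \<open>G\<close>, and whose first two coordinates
  both equal \<open>f \<bullet> x\<close>.
\<close>

lemma building_up_self_dual:
  assumes G: "generates_self_dual (2 * k) k G"
    and f: "f \<in> carrier_vec (2 * k)" "f \<bullet> f = 1"
    and gm: "generator_matrix (2 * k + 2) (k + 1) C (building_up_matrix k G f)"
  shows "self_dual_code (2 * k + 2) (k + 1) C"
proof -
  let ?n = "2 * k"
  let ?B = "building_up_matrix k G f"
  \<comment> \<open>On the rows of \<open>G\<close> this yields the lower rows of the matrix; as a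
    linear map it is also available on the whole code \<open>D\<close>.\<close>
  define ext where "ext x = vCons (f \<bullet> x) (vCons (f \<bullet> x) x)" for x
  define h where "h = vCons 1 (vCons 0 f)"
  interpret V: vec_module "TYPE(bit poly)" ?n .
  interpret W: vec_module "TYPE(bit poly)" "?n + 2" .
  obtain D where D: "D = dual_code ?n D" and gD: "generator_matrix ?n k D G"
    using G by (auto simp: generates_self_dual_def self_dual_code_def)
  note GD = generator_matrixD[OF gD]
  have ext_carrier: "ext x \<in> carrier_vec (?n + 2)" if "x \<in> carrier_vec ?n" for x
    using that by (simp add: ext_def)
  have h_carrier: "h \<in> carrier_vec (?n + 2)"
    using f by (simp add: h_def)
  have rows_eq: "set (rows ?B) = insert h (ext ` set (rows G))"
  proof -
    have "rows ?B = h # map ext (rows G)"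
      unfolding building_up_matrix_def
      using GD(1) h_carrier ext_carrier f(1)
      by (subst rows_mat_of_rows) (auto simp: h_def ext_def rows_def)
    then show ?thesis by simp
  qed
  have C: "C = W.span (set (rows ?B))"
    using gm by (simp add: generator_matrix_def)
  note BC = generator_matrixD[OF gm]
  have ort: "x \<bullet> y = 0" if "x \<in> D" "y \<in> D" for x y
    using that D by (auto simp: dual_code_def)
  have orthogonal: "u \<bullet> v = 0" if "u \<in> set (rows ?B)" "v \<in> set (rows ?B)" for u v
  proof -
    \<comment> \<open>Everything cancels in pairs: \<open>h\<close> with itself gives
      \<open>1 + f \<bullet> f\<close>, \<open>h\<close> with \<open>ext x\<close> gives
      \<open>f \<bullet> x\<close> twice, and the equal leading coordinates of \<open>ext x\<close>
      and \<open>ext y\<close> contribute one product twice.\<close>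
    have "h \<bullet> h = 0"
      using f by (simp add: h_def)
    moreover have "h \<bullet> ext x = 0" "ext x \<bullet> h = 0" if "x \<in> set (rows G)" for x
      using that f GD(2) comm_scalar_prod[of f ?n x] by (auto simp: h_def ext_def)
    moreover have "ext x \<bullet> ext y = 0" if "x \<in> set (rows G)" "y \<in> set (rows G)" for x y
      using that ort GD(3) by (auto simp: ext_def)
    ultimately show ?thesis
      using that unfolding rows_eq by auto
  qed
  have ext_C: "ext x \<in> C" if "x \<in> D" for x
  proof -
    \<comment> \<open>The preimage of \<open>C\<close> under \<open>ext\<close> is a submodule
      containing the rows of \<open>G\<close>, hence all of \<open>D\<close>.\<close>
    let ?N = "{x \<in> carrier_vec ?n. ext x \<in> C}"
    have "V.span (set (rows G)) \<subseteq> ?N"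
    proof (rule V.span_subset_closed)
      show "set (rows G) \<subseteq> ?N"
        using GD(2) BC(3) rows_eq by auto
      have "ext (0\<^sub>v ?n) = 0\<^sub>v (?n + 2)"
        using f by (simp add: ext_def zero_vec_Suc)
      then show "0\<^sub>v ?n \<in> ?N"
        using W.zero_in_span[OF BC(2)] C by simp
    next
      fix x y assume "x \<in> ?N" "y \<in> ?N"
      moreover from this have "ext (x + y) = ext x + ext y"
        using f scalar_prod_add_distrib[of f ?n x y] by (simp add: ext_def)
      ultimately show "x + y \<in> ?N"
        using W.add_in_span[OF BC(2)] C by simp
    next
      fix c x assume "x \<in> ?N"
      moreover from this have "ext (c \<cdot>\<^sub>v x) = c \<cdot>\<^sub>v ext x"
        using f by (simp add: ext_def)
      ultimately show "c \<cdot>\<^sub>v x \<in> ?N"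
        using W.scalar_mult_in_span[OF BC(2)] C by simp
    qed auto
    then show ?thesis
      using that gD by (auto simp: generator_matrix_def)
  qed
  have dual: "d \<in> C" if d: "d \<in> dual_code (?n + 2) (set (rows ?B))" for d
  proof -
    obtain u v w where d_eq: "d = vCons u (vCons v w)" and w: "w \<in> carrier_vec ?n"
      using d by (auto simp: dual_code_def carrier_vec_Suc_iff)
    define x where "x = w + (u + v) \<cdot>\<^sub>v f"
    have x: "x \<in> carrier_vec ?n"
      using w f by (simp add: x_def)
    have "d \<bullet> h = 0"
      using d rows_eq by (auto simp: dual_code_def)
    then have u: "u = w \<bullet> f"
      by (simp add: d_eq h_def bit_poly_add_eq_0_iff)
    have "x \<in> dual_code ?n (set (rows G))"
    proof -
      have "x \<bullet> g = 0" if g: "g \<in> set (rows G)" for g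
      proof -
        have "g \<in> carrier_vec ?n" using g GD(2) by blast
        \<comment> \<open>The left side expands to
          \<open>(u + v) * (f \<bullet> g) + w \<bullet> g\<close>, which is
          \<open>x \<bullet> g\<close>.\<close>
        moreover have "d \<bullet> ext g = 0"
          using d g rows_eq by (auto simp: dual_code_def)
        ultimately show ?thesis
          using w f by (simp add: x_def d_eq ext_def add_scalar_prod_distrib[of _ ?n] algebra_simps)
      qed
      then show ?thesis using x by (simp add: dual_code_def)
    qed
    moreover have "dual_code ?n (set (rows G)) = D"
      using D gD dual_code_span[OF GD(2)] by (simp add: generator_matrix_def)
    ultimately have "x \<in> D" by blast
    moreover have "d = (u + v) \<cdot>\<^sub>v h + ext x"
    proof -
      \<comment> \<open>Here \<open>f \<bullet> w = u\<close> and \<open>f \<bullet> f = 1\<close>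
        give \<open>u + (u + v) = v\<close>. The leading coordinates of the combination are then
        \<open>(u + v) + v = u\<close> and \<open>v\<close>, as required.\<close>
      have "f \<bullet> x = v"
        using w f u comm_scalar_prod[OF f(1) w]
        by (simp add: x_def scalar_prod_add_distrib[of _ ?n])
      moreover have "(u + v) \<cdot>\<^sub>v f + x = w"
        using w f by (intro eq_vecI) (auto simp: x_def add.left_commute)
      ultimately show ?thesis
        by (simp add: d_eq h_def ext_def)
    qed
    moreover have "h \<in> C"
      using BC(3) rows_eq by simp
    ultimately show ?thesis
      using ext_C W.add_in_span[OF BC(2)] W.scalar_mult_in_span[OF BC(2)] C by simp
  qed
  show ?thesis
    by (rule self_dual_codeI[OF gm orthogonal]) (use dual in auto)
qed

section \<open>The separating example\<close>

text \<open>Supplies the inner code of the example: orthogonality of \<open>(a, b)\<close> to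
  \<open>(1, 1)\<close> means \<open>a + b = 0\<close>, that is, \<open>a = b\<close> in
  characteristic two.\<close>

lemma self_dual_repetition:
  defines "G \<equiv> mat_of_rows 2 [vec_of_list [1, 1]]"
  shows "generates_self_dual 2 1 G"
proof -
  interpret vec_module "TYPE(bit poly)" 2 .
  define g :: "bit poly vec" where "g = vec_of_list [1, 1]"
  define C where "C = span {g}"
  have g: "g \<in> carrier_vec 2"
    by (simp add: g_def numeral_2_eq_2)
  have rows: "rows G = [g]"
    unfolding G_def g_def[symmetric] using g by (subst rows_mat_of_rows) auto
  have G: "G \<in> carrier_mat 1 2"
    by (auto simp: G_def)
  have "lin_indpt {g}"
    using g by (intro lin_indpt_pivots) (auto simp: g_def intro!: exI[of _ 0])
  then have gm: "generator_matrix 2 1 C G"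
    using G by (simp add: generator_matrix_def rows C_def)
  have "d \<in> C" if d: "d \<in> dual_code 2 {g}" for d
  proof -
    have "d \<in> carrier_vec (Suc (Suc 0))"
      using d by (simp add: dual_code_def numeral_eq_Suc)
    then obtain a b where ab: "d = vec_of_list [a, b]"
      unfolding carrier_vec_Suc_iff carrier_vec_0_iff by auto
    have "a = b"
      using d by (simp add: dual_code_def ab g_def bit_poly_add_eq_0_iff)
    then have "d = a \<cdot>\<^sub>v g"
      by (auto simp: ab g_def)
    then show ?thesis
      using g in_own_span[of "{g}"] scalar_mult_in_span[of "{g}" g a] by (simp add: C_def)
  qed
  then have "self_dual_code 2 1 C"
    by (intro self_dual_codeI[OF gm]) (auto simp: rows g_def)
  then show ?thesis
    using gm unfolding generates_self_dual_def by blast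
qed

text \<open>The first two coordinates of every codeword agree, so none begins with
  \<open>1, 0\<close>. This obstruction, for all \<open>f\<close> at once, later rules out every
  building-up matrix.\<close>

lemma self_dual_double_repetition:
  defines "M \<equiv> harada_munemasa_matrix 1 (mat_of_rows 2 [vec_of_list [1, 1]]) (0\<^sub>v 1)
    (vec_of_list [1, 1, 0, 0])"
  obtains C where "generator_matrix 4 2 C M" "self_dual_code 4 2 C"
    "\<And>f. vCons 1 (vCons 0 f) \<notin> C"
proof -
  interpret vec_module "TYPE(bit poly)" 4 .
  \<comment> \<open>\<open>g\<close> is the chosen first row; \<open>h\<close> is the inner row
    \<open>(1, 1)\<close> preceded twice by the entry 0 of the zero vector chosen for
    \<open>a\<close>.\<close>
  define g h :: "bit poly vec"
    where "g = vec_of_list [1, 1, 0, 0]" and "h = vec_of_list [0, 0, 1, 1]"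
  define C where "C = span {g, h}"
  have gh: "g \<in> carrier_vec 4" "h \<in> carrier_vec 4"
    by (simp_all add: g_def h_def numeral_eq_Suc)
  have M_eq: "M = mat_of_rows 4 [g, h]"
    by (simp add: M_def harada_munemasa_matrix_def g_def h_def numeral_eq_Suc)
  have rows: "rows M = [g, h]"
    unfolding M_eq using gh by (subst rows_mat_of_rows) auto
  have M: "M \<in> carrier_mat 2 4"
    by (auto simp: M_eq)
  have "g \<noteq> h"
    by (simp add: g_def h_def)
  moreover have "lin_indpt {g, h}"
  proof (rule lin_indpt_pivots)
    fix v assume "v \<in> {g, h}"
    moreover have "g $ 0 = 1" "h $ 0 = 0" "g $ 2 = 0" "h $ 2 = 1"
      by (simp_all add: g_def h_def numeral_eq_Suc)
    ultimately show "\<exists>i<4. v $ i = 1 \<and> (\<forall>w\<in>{g, h} - {v}. w $ i = 0)"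
      by (auto intro: exI[of _ 0] exI[of _ 2])
  qed (use gh in auto)
  ultimately have gm: "generator_matrix 4 2 C M"
    using M by (simp add: generator_matrix_def rows C_def)
  \<comment> \<open>This shape is used twice: to place dual vectors in \<open>C\<close>, and, once
    \<open>C\<close> equals its dual, to describe the codewords themselves.\<close>
  have dual: "\<exists>a b. d = vec_of_list [a, a, b, b]" if d: "d \<in> dual_code 4 {g, h}" for d
  proof -
    have "d \<in> carrier_vec (Suc (Suc (Suc (Suc 0))))"
      using d by (simp add: dual_code_def numeral_eq_Suc)
    then obtain a b c e where "d = vec_of_list [a, b, c, e]"
      unfolding carrier_vec_Suc_iff carrier_vec_0_iff by auto
    then show ?thesis
      using d by (simp add: dual_code_def g_def h_def bit_poly_add_eq_0_iff)
  qed
  have "d \<in> C" if d: "d \<in> dual_code 4 {g, h}" for d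
  proof -
    obtain a b where "d = vec_of_list [a, a, b, b]"
      using dual[OF d] by blast
    then have "d = a \<cdot>\<^sub>v g + b \<cdot>\<^sub>v h"
      by (auto simp: g_def h_def)
    moreover have W: "{g, h} \<subseteq> carrier_vec 4"
      using gh by simp
    moreover have "g \<in> span {g, h}" "h \<in> span {g, h}"
      using in_own_span[OF W] by auto
    ultimately show ?thesis
      unfolding C_def by (auto intro!: add_in_span scalar_mult_in_span)
  qed
  then have sd: "self_dual_code 4 2 C"
    by (intro self_dual_codeI[OF gm]) (auto simp: rows g_def h_def)
  have "vCons 1 (vCons 0 f) \<notin> C" for f
  proof
    assume "vCons 1 (vCons 0 f) \<in> C"
    moreover have "C = dual_code 4 {g, h}"
      using sd dual_code_span[of "{g, h}" 4] gh by (simp add: self_dual_code_def C_def)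
    ultimately obtain a b :: "bit poly" where "vCons 1 (vCons 0 f) = vec_of_list [a, a, b, b]"
      using dual by blast
    then show False by auto
  qed
  with gm sd show ?thesis by (rule that)
qed

section \<open>Inclusion and strictness\<close>

theorem lemma15:
  shows "(\<forall>n k C. convolutional_code n k C \<longrightarrow>
            constructible building_up_matrices n k C \<longrightarrow>
            constructible harada_munemasa_matrices n k C) \<and>
         (\<exists>n k C. self_dual_code n k C \<and>
            constructible harada_munemasa_matrices n k C \<and>
            \<not> constructible building_up_matrices n k C)"
proof (intro conjI allI impI)
  fix n k C
  assume "constructible building_up_matrices n k C"
  then obtain l G f where gm: "generator_matrix n k C (building_up_matrix l G f)"
    and G: "1 \<le> l" "generates_self_dual (2 * l) l G"
    and f: "f \<in> carrier_vec (2 * l)" "f \<bullet> f = 1"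
    by (auto simp: constructible_def building_up_matrices_def)
  define a where "a = vec l (\<lambda>i. f \<bullet> row G i)"
  define h where "h = vCons 1 (vCons 0 f)"
  have eq: "building_up_matrix l G f = harada_munemasa_matrix l G a h"
    by (auto simp: building_up_matrix_def harada_munemasa_matrix_def a_def h_def
        intro!: arg_cong[where f = "mat_of_rows _"])
  \<comment> \<open>Constructibility does not tie \<open>n\<close> and \<open>k\<close> to the inner
    dimension \<open>l\<close>; the size of the matrix does.\<close>
  have "building_up_matrix l G f \<in> carrier_mat (l + 1) (2 * l + 2)"
    by (simp add: building_up_matrix_def mat_of_rows_def)
  then have "n = 2 * l + 2" "k = l + 1"
    using generator_matrixD(1)[OF gm] by auto
  then have "generates_self_dual (2 * l + 2) (l + 1) (harada_munemasa_matrix l G a h)"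
    using building_up_self_dual[OF G(2) f] gm unfolding eq generates_self_dual_def by blast
  moreover have "a \<in> carrier_vec l" "h \<in> carrier_vec (2 * l + 2)"
    using f by (simp_all add: a_def h_def)
  ultimately have "building_up_matrix l G f \<in> harada_munemasa_matrices"
    using G unfolding eq harada_munemasa_matrices_def by blast
  then show "constructible harada_munemasa_matrices n k C"
    using gm unfolding constructible_def by blast
next
  let ?G = "mat_of_rows 2 [vec_of_list [1, 1]] :: bit poly mat"
  let ?f = "vec_of_list [1, 1, 0, 0] :: bit poly vec"
  let ?M = "harada_munemasa_matrix 1 ?G (0\<^sub>v 1) ?f"
  obtain C where gm: "generator_matrix 4 2 C ?M" and sd: "self_dual_code 4 2 C"
    and C: "\<And>f. vCons 1 (vCons 0 f) \<notin> C"
    by (rule self_dual_double_repetition) (rule that)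
  have "generates_self_dual 4 2 ?M"
    using gm sd unfolding generates_self_dual_def by blast
  then have "generates_self_dual (2 * 1 + 2) (1 + 1) ?M"
    by (simp add: numeral_eq_Suc)
  moreover have "generates_self_dual (2 * 1) 1 ?G"
    using self_dual_repetition by simp
  moreover have "?f \<in> carrier_vec (2 * 1 + 2)"
    by (simp add: numeral_eq_Suc)
  moreover have "(0\<^sub>v 1 :: bit poly vec) \<in> carrier_vec 1" "1 \<le> (1 :: nat)"
    by simp_all
  ultimately have "?M \<in> harada_munemasa_matrices"
    unfolding harada_munemasa_matrices_def by (intro CollectI exI conjI) (rule refl | assumption)+
  then have "constructible harada_munemasa_matrices 4 2 C"
    using gm unfolding constructible_def by blast
  \<comment> \<open>The rows of a generator matrix are codewords, and the first row here begins with
    \<open>1, 0\<close>.\<close>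
  moreover have "\<not> generator_matrix 4 2 C (building_up_matrix l G f)"
    if f: "f \<in> carrier_vec (2 * l)" for l G f
  proof
    assume gm: "generator_matrix 4 2 C (building_up_matrix l G f)"
    have "row (building_up_matrix l G f) 0 = vCons 1 (vCons 0 f)"
      using f by (simp add: building_up_matrix_def)
    moreover have "row (building_up_matrix l G f) 0 \<in> set (rows (building_up_matrix l G f))"
      unfolding rows_def by (auto simp: building_up_matrix_def simp del: upt_Suc)
    ultimately show False
      using generator_matrixD(3)[OF gm] C by auto
  qed
  then have "\<not> constructible building_up_matrices 4 2 C"
    by (auto simp: constructible_def building_up_matrices_def)
  ultimately show "\<exists>n k C. self_dual_code n k C \<and>
      constructible harada_munemasa_matrices n k C \<and>
      \<not> constructible building_up_matrices n k C"
    using sd by blast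
qed

end
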